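(* For any algorithm that employs primal-dual estimate functions updated as $$\psi_{k+1}(y,g)=\psi_k(y,g)+a_{k+1}w_{k+1}(y,g),\quad y\in\mathbb{E},\ g\in\mathbb{E}^*,\ k\ge0,$$ with the simple lower bounds $$w_{k+1}(y,g)=f(y_{k+1})+\langle\nabla f(y_{k+1}),y-y_{k+1}\rangle+\frac{1}{2L_f}\|g-\nabla f(y_{k+1})\|_*^2,$$ we have, for all $k\ge0$, $$\Gamma_{k+1}\ge\Gamma_k+\left(\frac{A_k+A_{k+1}}{2L_f}-\frac{a_{k+1}^2}{2}\right)\|\nabla f(y_{k+1})\|_*^2+\left\langle\nabla f(y_{k+1}),A_k\left(y_k-\frac{1}{L_f}B^{-1}\nabla f(y_k)\right)+a_{k+1}v_k-A_{k+1}y_{k+1}\right\rangle,$$ where $A_{k+1}=A_k+a_{k+1}$.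
   Context: $\mathbb{E}$ is an $n$-dimensional real vector space, $\mathbb{E}^*$ its dual, $\langle s,x\rangle$ the value of $s\in\mathbb{E}^*$ at $x\in\mathbb{E}$. $B:\mathbb{E}\to\mathbb{E}^*$ is a symmetric positive definite linear operator, $\|x\|=\sqrt{\langle Bx,x\rangle}$ on $\mathbb{E}$ and $\|g\|_*=\sqrt{\langle g,B^{-1}g\rangle}$ on $\mathbb{E}^*$. $f:\mathbb{E}\to\mathbb{R}$ is convex and differentiable, with gradient Lipschitz continuous with constant $L_f>0$ (i.e. $\|\nabla f(x)-\nabla f(y)\|_*\le L_f\|x-y\|$). The algorithm has starting point $x_0\in\mathbb{E}$, auxiliary points $y_k\in\mathbb{E}$ ($y_0=x_0$) and weights $a_{k+1}>0$, with $A_0=0$ and $A_{k+1}=A_k+a_{k+1}$. The estimate functions start from $\psi_0(y,g)=\frac12\|y-x_0\|^2$. $\psi_k^*=\min_{y\in\mathbb{E},g\in\mathbb{E}^*}\psi_k(y,g)$, and $(v_k,s_k)$ denotes the minimizer of $\psi_k$ (with $v_0=x_0$, $s_0=0$; $v_k$ is unique for all $k\ge 0$). The gaps are $$\Gamma_k=\psi_k^*-A_kf(y_k)+\frac{A_k}{2L_f}\|\nabla f(y_k)\|_*^2 ,$$ with $\Gamma_0=0$ by this formula. *)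

theory Defs
  imports "HOL-Analysis.Analysis"
begin

text \<open>
  The space E is a type \<open>'a :: euclidean_space\<close> and its dual is the type of (bounded) linear
  functionals \<open>'a \<Rightarrow>\<^sub>L real\<close>; the pairing \<open>\<langle>s, x\<rangle>\<close> is \<open>blinfun_apply s x\<close>. The inner product and
  norm that come with the type class are used only as a topology, namely in the notion of
  derivative, which in finite dimension does not depend on the choice of the norm. All norms
  in the statement are those induced by the operator \<open>B\<close>.
\<close>

definition sym_pos_def :: "('a::euclidean_space \<Rightarrow> ('a \<Rightarrow>\<^sub>L real)) \<Rightarrow> bool" where
  "sym_pos_def B \<longleftrightarrow> linear B \<and>
     (\<forall>x y. blinfun_apply (B x) y = blinfun_apply (B y) x) \<and>
     (\<forall>x. x \<noteq> 0 \<longrightarrow> blinfun_apply (B x) x > 0)"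

definition primal_norm :: "('a::euclidean_space \<Rightarrow> ('a \<Rightarrow>\<^sub>L real)) \<Rightarrow> 'a \<Rightarrow> real" where
  "primal_norm B x = sqrt (blinfun_apply (B x) x)"

definition dual_norm :: "('a::euclidean_space \<Rightarrow> ('a \<Rightarrow>\<^sub>L real)) \<Rightarrow> ('a \<Rightarrow>\<^sub>L real) \<Rightarrow> real" where
  "dual_norm B g = sqrt (blinfun_apply g (inv B g))"

text \<open>The gradient is the Frechet derivative as an element of the dual space; no identification
  of the space with its dual is involved.\<close>

definition gradient :: "('a::euclidean_space \<Rightarrow> real) \<Rightarrow> 'a \<Rightarrow> ('a \<Rightarrow>\<^sub>L real)" where
  "gradient f x = Blinfun (frechet_derivative f (at x))"

definition simple_lower_bound ::
  "('a::euclidean_space \<Rightarrow> ('a \<Rightarrow>\<^sub>L real)) \<Rightarrow> real \<Rightarrow> ('a \<Rightarrow> real) \<Rightarrow> 'a \<Rightarrow> 'a \<Rightarrow> ('a \<Rightarrow>\<^sub>L real) \<Rightarrow> real"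
where
  "simple_lower_bound B L f z y g =
     f z + blinfun_apply (gradient f z) (y - z)
       + 1 / (2 * L) * (dual_norm B (g - gradient f z))\<^sup>2"

text \<open>For an estimate function that has a minimizer, the infimum below is its minimum.\<close>

definition opt_value :: "('a \<Rightarrow> 'b \<Rightarrow> real) \<Rightarrow> real" where
  "opt_value \<psi> = (INF p. case_prod \<psi> p)"

definition gap ::
  "('a::euclidean_space \<Rightarrow> ('a \<Rightarrow>\<^sub>L real)) \<Rightarrow> real \<Rightarrow> ('a \<Rightarrow> real) \<Rightarrow> (nat \<Rightarrow> real) \<Rightarrow> (nat \<Rightarrow> 'a) \<Rightarrow>
    (nat \<Rightarrow> 'a \<Rightarrow> ('a \<Rightarrow>\<^sub>L real) \<Rightarrow> real) \<Rightarrow> nat \<Rightarrow> real"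
where
  "gap B L f A y \<psi> k =
     opt_value (\<psi> k) - A k * f (y k) + A k / (2 * L) * (dual_norm B (gradient f (y k)))\<^sup>2"

end

theory Submission
  imports Defs
begin

text \<open>
  Every estimate function splits as \<open>\<psi>\<^sub>k(u, g) = P\<^sub>k(u) + D\<^sub>k(g)\<close>, where \<open>P\<^sub>k\<close> is half the squared
  distance to \<open>x\<^sub>0\<close> plus an affine function, so \<open>\<psi>\<^sub>k\<close> exceeds its minimum by at least
  \<open>\<parallel>u - v\<^sub>k\<parallel>\<^sup>2 / 2\<close>. Evaluating \<open>\<psi>\<^sub>k\<^sub>+\<^sub>1\<close> at its minimizer and completing the square in
  \<open>v\<^sub>k\<^sub>+\<^sub>1 - v\<^sub>k\<close> bounds the growth of the minimum from below; the nonnegative dual term of the new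
  lower bound is dropped. The gap inequality then follows from
  \<open>f(y\<^sub>k) \<ge> f(y\<^sub>k\<^sub>+\<^sub>1) + \<langle>\<nabla>f(y\<^sub>k\<^sub>+\<^sub>1), y\<^sub>k - y\<^sub>k\<^sub>+\<^sub>1\<rangle> + \<parallel>\<nabla>f(y\<^sub>k) - \<nabla>f(y\<^sub>k\<^sub>+\<^sub>1)\<parallel>\<^sub>*\<^sup>2 / (2 L)\<close>,
  multiplied by \<open>A\<^sub>k\<close>, after expanding the dual norm.
\<close>

section \<open>The operator \<open>B\<close>, its inverse and the two norms\<close>

lemma sym_pos_defD:
  assumes "sym_pos_def B"
  shows "linear B" "blinfun_apply (B x) z = blinfun_apply (B z) x"
    "x \<noteq> 0 \<Longrightarrow> blinfun_apply (B x) x > 0"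
  using assms by (auto simp: sym_pos_def_def)

lemma sym_pos_def_nonneg:
  assumes "sym_pos_def B"
  shows "blinfun_apply (B x) x \<ge> 0"
  using sym_pos_defD(3)[OF assms, of x] by (cases "x = 0") auto

text \<open>Definiteness makes the kernel trivial. Reading off coordinates in \<open>Basis\<close>
  by \<open>M\<close> turns \<open>B\<close> into an injective endomorphism, which is onto by
  dimension. This is what makes \<open>inv B\<close> a genuine inverse.\<close>

lemma sym_pos_def_bij:
  fixes B :: "'a::euclidean_space \<Rightarrow> ('a \<Rightarrow>\<^sub>L real)"
  assumes "sym_pos_def B"
  shows "bij B"
proof (rule bijI)
  note lin = sym_pos_defD(1)[OF assms]
  show "inj B"
    unfolding linear_injective_0[OF lin] using sym_pos_defD(3)[OF assms]
    by (metis less_irrefl zero_blinfun.rep_eq)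
  define M :: "('a \<Rightarrow>\<^sub>L real) \<Rightarrow> 'a" where "M g = (\<Sum>b\<in>Basis. blinfun_apply g b *\<^sub>R b)" for g
  have M_inner: "M g \<bullet> b = blinfun_apply g b" if "b \<in> Basis" for g b
    using that by (simp add: M_def)
  have M_inj: "g = h" if "M g = M h" for g h
    by (rule blinfun_euclidean_eqI) (metis M_inner that)
  have "linear M"
    by (rule linearI)
      (simp_all add: M_def blinfun.add_left blinfun.scaleR_left scaleR_add_left sum.distrib scaleR_sum_right)
  then have "linear (M \<circ> B)"
    by (rule linear_compose[OF lin])
  moreover have "inj (M \<circ> B)"
    by (metis \<open>inj B\<close> M_inj injI inj_compose)
  ultimately have "surj (M \<circ> B)"
    by (rule linear_inj_imp_surj)
  show "surj B"
    unfolding surj_def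
  proof
    fix g
    obtain x where "M g = (M \<circ> B) x"
      using \<open>surj (M \<circ> B)\<close> by (rule surjE)
    then have "g = B x"
      by (intro M_inj) simp
    then show "\<exists>x. g = B x" ..
  qed
qed

lemma apply_inv_sym_pos_def:
  assumes "sym_pos_def B"
  shows "B (inv B g) = g"
  using sym_pos_def_bij[OF assms] by (simp add: bij_is_surj surj_f_inv_f)

lemma linear_inv_sym_pos_def:
  assumes "sym_pos_def B"
  shows "linear (inv B)"
  by (rule linearI)
    (metis apply_inv_sym_pos_def[OF assms] sym_pos_def_bij[OF assms] bij_is_inj inv_f_f
      linear_add[OF sym_pos_defD(1)[OF assms]] linear_scale[OF sym_pos_defD(1)[OF assms]])+

lemma primal_norm_power2:
  assumes "sym_pos_def B"
  shows "(primal_norm B x)\<^sup>2 = blinfun_apply (B x) x"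
  using sym_pos_def_nonneg[OF assms] by (simp add: primal_norm_def)

lemma dual_norm_eq_primal_norm:
  assumes "sym_pos_def B"
  shows "dual_norm B g = primal_norm B (inv B g)"
  by (simp add: dual_norm_def primal_norm_def apply_inv_sym_pos_def[OF assms])

lemma dual_norm_power2:
  assumes "sym_pos_def B"
  shows "(dual_norm B g)\<^sup>2 = blinfun_apply g (inv B g)"
  by (simp add: dual_norm_eq_primal_norm primal_norm_power2 apply_inv_sym_pos_def assms)

lemma primal_norm_nonneg:
  assumes "sym_pos_def B"
  shows "primal_norm B x \<ge> 0"
  using sym_pos_def_nonneg[OF assms] by (simp add: primal_norm_def)

lemma primal_norm_scaleR:
  assumes "sym_pos_def B"
  shows "primal_norm B (c *\<^sub>R x) = \<bar>c\<bar> * primal_norm B x"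
proof -
  have "blinfun_apply (B (c *\<^sub>R x)) (c *\<^sub>R x) = c\<^sup>2 * blinfun_apply (B x) x"
    by (simp add: linear_scale[OF sym_pos_defD(1)[OF assms]] blinfun.bilinear_simps power2_eq_square)
  then show ?thesis
    by (simp add: primal_norm_def real_sqrt_mult)
qed

lemma primal_norm_add_power2:
  assumes "sym_pos_def B"
  shows "(primal_norm B (x + z))\<^sup>2
    = (primal_norm B x)\<^sup>2 + 2 * blinfun_apply (B x) z + (primal_norm B z)\<^sup>2"
  using sym_pos_defD(2)[OF assms, of z x]
  by (simp add: primal_norm_power2[OF assms] linear_add[OF sym_pos_defD(1)[OF assms]]
      blinfun.bilinear_simps)

text \<open>The cross terms merge because \<open>inv B\<close> inherits the symmetry of
  \<open>B\<close>; the one kept has the form needed in the gap inequality.\<close>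

lemma dual_norm_diff_power2:
  assumes "sym_pos_def B"
  shows "(dual_norm B (g - h))\<^sup>2
    = (dual_norm B g)\<^sup>2 - 2 * blinfun_apply h (inv B g) + (dual_norm B h)\<^sup>2"
proof -
  have "blinfun_apply g (inv B h) = blinfun_apply h (inv B g)"
    using sym_pos_defD(2)[OF assms, of "inv B g" "inv B h"]
    by (simp add: apply_inv_sym_pos_def[OF assms])
  then show ?thesis
    by (simp add: dual_norm_power2[OF assms] linear_diff[OF linear_inv_sym_pos_def[OF assms]]
        blinfun.bilinear_simps)
qed

text \<open>Expand the squares of \<open>inv B g + x\<close> and \<open>inv B g - x\<close>; the two
  signs together give the absolute value.\<close>

lemma pairing_young:
  assumes "sym_pos_def B"
  shows "\<bar>blinfun_apply g x\<bar> \<le> (dual_norm B g)\<^sup>2 / 2 + (primal_norm B x)\<^sup>2 / 2"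
proof -
  have "0 \<le> (primal_norm B (inv B g + c *\<^sub>R x))\<^sup>2" for c
    by simp
  then have "0 \<le> (dual_norm B g)\<^sup>2 + 2 * (c * blinfun_apply g x) + c\<^sup>2 * (primal_norm B x)\<^sup>2" for c
    by (simp add: primal_norm_add_power2[OF assms] primal_norm_scaleR[OF assms]
        dual_norm_eq_primal_norm[OF assms] apply_inv_sym_pos_def[OF assms]
        blinfun.bilinear_simps power_mult_distrib)
  from this[of 1] this[of "-1"] show ?thesis
    by simp
qed

text \<open>Cauchy-Schwarz, from Young's inequality by homogeneity.\<close>

lemma pairing_le_dual_norm_primal_norm:
  assumes "sym_pos_def B"
  shows "blinfun_apply g x \<le> dual_norm B g * primal_norm B x"
proof (cases "x = 0")
  case True
  then show ?thesis
    by (simp add: primal_norm_def linear_0[OF sym_pos_defD(1)[OF assms]])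
next
  case False
  define p where "p = primal_norm B x"
  define d where "d = dual_norm B g"
  have p: "p > 0"
    using sym_pos_defD(3)[OF assms False] by (simp add: p_def primal_norm_def)
  have d: "d \<ge> 0"
    by (simp add: d_def dual_norm_eq_primal_norm[OF assms] primal_norm_nonneg[OF assms])
  \<comment> \<open>The factor \<open>d / p\<close> makes the two norms equal, so that the
    arithmetic mean in Young's inequality becomes their product.\<close>
  have "\<bar>blinfun_apply g ((d / p) *\<^sub>R x)\<bar> \<le> d\<^sup>2 / 2 + (primal_norm B ((d / p) *\<^sub>R x))\<^sup>2 / 2"
    unfolding d_def by (rule pairing_young[OF assms])
  also have "primal_norm B ((d / p) *\<^sub>R x) = d"
    using p d by (simp add: primal_norm_scaleR[OF assms] p_def[symmetric])
  finally have *: "d * blinfun_apply g x \<le> d * (d * p)"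
    using p d by (simp add: blinfun.bilinear_simps field_simps power2_eq_square)
  \<comment> \<open>Cancelling \<open>d\<close> requires it to be nonzero; a zero dual norm forces
    \<open>g = 0\<close> by definiteness.\<close>
  show ?thesis
  proof (cases "d = 0")
    case True
    then have "inv B g = 0"
      using sym_pos_defD(3)[OF assms, of "inv B g"]
      by (auto simp: d_def dual_norm_eq_primal_norm[OF assms] primal_norm_def)
    then have "g = 0"
      by (metis apply_inv_sym_pos_def[OF assms] linear_0[OF sym_pos_defD(1)[OF assms]])
    then show ?thesis
      using True by (simp add: d_def)
  next
    case False
    then show ?thesis
      using * d by (simp add: p_def d_def)
  qed
qed

section \<open>Gradient inequalities for smooth convex functions\<close>

lemma has_derivative_gradient:
  assumes "f differentiable (at x)"
  shows "(f has_derivative blinfun_apply (gradient f x)) (at x)"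
proof -
  have "(f has_derivative frechet_derivative f (at x)) (at x)"
    using assms by (simp add: frechet_derivative_works)
  then show ?thesis
    by (simp add: gradient_def bounded_linear_Blinfun_apply has_derivative_bounded_linear)
qed

lemma has_real_derivative_along_line:
  assumes "\<And>x. f differentiable (at x)"
  shows "((\<lambda>t. f (x + t *\<^sub>R d)) has_real_derivative blinfun_apply (gradient f (x + t *\<^sub>R d)) d) (at t)"
proof -
  have "((\<lambda>t. x + t *\<^sub>R d) has_derivative (\<lambda>h. h *\<^sub>R d)) (at t)"
    by (auto intro!: derivative_eq_intros)
  from has_derivative_compose[OF this has_derivative_gradient[OF assms]]
  show ?thesis
    by (simp add: has_field_derivative_def mult_commute_abs blinfun.bilinear_simps)
qed

text \<open>Restricted to the line through \<open>x\<close> and \<open>z\<close>, \<open>f\<close>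
  is a convex function of one real variable; its tangent at 0 is compared with its value at
  1.\<close>

lemma convex_above_gradient:
  assumes "convex_on UNIV f" and "\<And>x. f differentiable (at x)"
  shows "f x + blinfun_apply (gradient f x) (z - x) \<le> f z"
proof -
  have "convex_on UNIV (\<lambda>t::real. f (x + t *\<^sub>R (z - x)))"
  proof (rule convex_onI)
    fix t s r :: real
    assume "0 < t" "t < 1"
    moreover have "x + ((1 - t) *\<^sub>R s + t *\<^sub>R r) *\<^sub>R (z - x)
        = (1 - t) *\<^sub>R (x + s *\<^sub>R (z - x)) + t *\<^sub>R (x + r *\<^sub>R (z - x))"
      by (simp add: algebra_simps)
    ultimately show "f (x + ((1 - t) *\<^sub>R s + t *\<^sub>R r) *\<^sub>R (z - x))
        \<le> (1 - t) * f (x + s *\<^sub>R (z - x)) + t * f (x + r *\<^sub>R (z - x))"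
      using convex_onD[OF assms(1), of t] by simp
  qed simp
  from convex_on_imp_above_tangent[OF this, of 0 1 "blinfun_apply (gradient f x) (z - x)"]
    has_real_derivative_along_line[OF assms(2), of x "z - x" 0]
  show ?thesis
    by simp
qed

text \<open>Along the segment, the quadratic model minus \<open>f\<close> has a nonnegative
  derivative, by Cauchy-Schwarz and the Lipschitz bound. Monotonicity thus replaces integration of
  the gradient.\<close>

lemma descent_lemma:
  assumes B: "sym_pos_def B" and diff: "\<And>x. f differentiable (at x)"
    and Lipschitz: "\<And>x z. dual_norm B (gradient f x - gradient f z) \<le> L * primal_norm B (x - z)"
  shows "f (x + d) \<le> f x + blinfun_apply (gradient f x) d + L / 2 * (primal_norm B d)\<^sup>2"
proof -
  define h where
    "h t = t * blinfun_apply (gradient f x) d + L / 2 * t\<^sup>2 * (primal_norm B d)\<^sup>2 - f (x + t *\<^sub>R d)"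
    for t
  define h' where
    "h' t = blinfun_apply (gradient f x) d + L * t * (primal_norm B d)\<^sup>2
      - blinfun_apply (gradient f (x + t *\<^sub>R d)) d" for t
  have deriv: "(h has_real_derivative h' t) (at t)" for t
    unfolding h_def h'_def
    by (rule derivative_eq_intros has_real_derivative_along_line[OF diff] refl)+ simp
  have nonneg: "h' t \<ge> 0" if "0 \<le> t" for t
  proof -
    have "blinfun_apply (gradient f (x + t *\<^sub>R d) - gradient f x) d
        \<le> dual_norm B (gradient f (x + t *\<^sub>R d) - gradient f x) * primal_norm B d"
      by (rule pairing_le_dual_norm_primal_norm[OF B])
    also have "\<dots> \<le> L * primal_norm B (x + t *\<^sub>R d - x) * primal_norm B d"
      by (intro mult_right_mono Lipschitz primal_norm_nonneg[OF B])
    also have "\<dots> = L * t * (primal_norm B d)\<^sup>2"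
      using that by (simp add: primal_norm_scaleR[OF B] power2_eq_square)
    finally show ?thesis
      by (simp add: h'_def blinfun.bilinear_simps)
  qed
  have "h 0 \<le> h 1"
    by (rule DERIV_nonneg_imp_nondecreasing) (use deriv nonneg in auto)
  then show ?thesis
    by (simp add: h_def)
qed

text \<open>Apply the descent lemma to a gradient step of \<open>f - \<langle>\<nabla>f(x), \<cdot>\<rangle>\<close> from \<open>z\<close>; this
  function is minimal at \<open>x\<close>.\<close>

lemma convex_Lipschitz_gradient_lower_bound:
  assumes B: "sym_pos_def B" and convex: "convex_on UNIV f"
    and diff: "\<And>x. f differentiable (at x)" and L_pos: "L > 0"
    and Lipschitz: "\<And>x z. dual_norm B (gradient f x - gradient f z) \<le> L * primal_norm B (x - z)"
  shows "simple_lower_bound B L f x z (gradient f z) \<le> f z"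
proof -
  define g where "g = gradient f z - gradient f x"
  \<comment> \<open>This choice minimizes the bound
    \<open><g, d> + L / 2 * (primal_norm B d)^2\<close>; the minimum is the dual term of the claim
    with a minus sign.\<close>
  define d where "d = - (1 / L) *\<^sub>R inv B g"
  have "f x + blinfun_apply (gradient f x) (z + d - x) \<le> f (z + d)"
    by (rule convex_above_gradient[OF convex diff])
  also have "\<dots> \<le> f z + blinfun_apply (gradient f z) d + L / 2 * (primal_norm B d)\<^sup>2"
    by (rule descent_lemma[OF B diff Lipschitz])
  finally have "f x + blinfun_apply (gradient f x) (z - x)
      \<le> f z + blinfun_apply g d + L / 2 * (primal_norm B d)\<^sup>2"
    by (simp add: g_def blinfun.bilinear_simps)
  moreover have "blinfun_apply g d = - (1 / L) * (dual_norm B g)\<^sup>2"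
    by (simp add: d_def blinfun.bilinear_simps dual_norm_power2[OF B])
  moreover have "L / 2 * (primal_norm B d)\<^sup>2 = 1 / (2 * L) * (dual_norm B g)\<^sup>2"
    using L_pos unfolding d_def primal_norm_scaleR[OF B] dual_norm_eq_primal_norm[OF B]
    by (simp add: power2_eq_square)
  ultimately show ?thesis
    by (simp add: simple_lower_bound_def g_def[symmetric])
qed

section \<open>Minimizers of quadratics and of estimate functions\<close>

text \<open>The second-order expansion at \<open>v\<close> is exact, and its linear term
  \<open>m\<close> vanishes because \<open>v\<close> is a minimizer.\<close>

lemma primal_quadratic_at_minimizer:
  assumes B: "sym_pos_def B"
    and q: "\<And>u. q u = (primal_norm B (u - x))\<^sup>2 / 2 + blinfun_apply l u + c"
    and min: "\<And>u. q v \<le> q u"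
  shows "q u = q v + (primal_norm B (u - v))\<^sup>2 / 2"
proof -
  define m where "m = B (v - x) + l"
  have expand: "q (v + d) = q v + blinfun_apply m d + (primal_norm B d)\<^sup>2 / 2" for d
    using primal_norm_add_power2[OF B, of "v - x" d]
    by (simp add: q m_def blinfun.bilinear_simps algebra_simps)
  \<comment> \<open>A unit step along \<open>- inv B m\<close> changes \<open>q\<close> by minus
    half the squared dual norm of \<open>m\<close>.\<close>
  have "(dual_norm B m)\<^sup>2 \<le> 0"
    using min[of "v + - inv B m"] unfolding expand
    by (simp add: blinfun.bilinear_simps dual_norm_power2[OF B, symmetric]
        primal_norm_scaleR[OF B, of "-1", simplified] dual_norm_eq_primal_norm[OF B])
  then have "primal_norm B (inv B m) = 0"
    by (simp add: dual_norm_eq_primal_norm[OF B])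
  then have "blinfun_apply m d = 0" for d
    using pairing_le_dual_norm_primal_norm[OF B, of m d]
      pairing_le_dual_norm_primal_norm[OF B, of m "- d"]
    by (simp add: dual_norm_eq_primal_norm[OF B] blinfun.bilinear_simps)
  then show ?thesis
    using expand[of "u - v"] by simp
qed

lemma opt_value_eq_arg_min:
  fixes \<psi> :: "'a \<Rightarrow> 'b \<Rightarrow> real"
  assumes "is_arg_min (case_prod \<psi>) (\<lambda>_. True) (v, s)"
  shows "opt_value \<psi> = \<psi> v s"
  unfolding opt_value_def
proof (rule cInf_eq_minimum)
  show "\<psi> v s \<in> range (case_prod \<psi>)"
    by (rule range_eqI[of _ _ "(v, s)"]) simp
next
  fix r
  assume "r \<in> range (case_prod \<psi>)"
  then show "\<psi> v s \<le> r"
    using assms by (auto simp: is_arg_min_linorder)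
qed

section \<open>Growth of the gap in one iteration\<close>

theorem theorem4p1:
  fixes B :: "'a::euclidean_space \<Rightarrow> ('a \<Rightarrow>\<^sub>L real)"
    and f :: "'a \<Rightarrow> real"
    and L :: real
    and x0 :: 'a
    and y v :: "nat \<Rightarrow> 'a"
    and s :: "nat \<Rightarrow> ('a \<Rightarrow>\<^sub>L real)"
    and a A :: "nat \<Rightarrow> real"
    and \<psi> w :: "nat \<Rightarrow> 'a \<Rightarrow> ('a \<Rightarrow>\<^sub>L real) \<Rightarrow> real"
    and \<Gamma> :: "nat \<Rightarrow> real"
  assumes B: "sym_pos_def B"
    and convex: "convex_on UNIV f"
    and diff: "\<And>x. f differentiable (at x)"
    and L_pos: "L > 0"
    and Lipschitz: "\<And>x z. dual_norm B (gradient f x - gradient f z) \<le> L * primal_norm B (x - z)"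
    and y_0: "y 0 = x0"
    and a_pos: "\<And>k. a (Suc k) > 0"
    and A_0: "A 0 = 0"
    and A_Suc: "\<And>k. A (Suc k) = A k + a (Suc k)"
    and psi_0: "\<And>u g. \<psi> 0 u g = 1 / 2 * (primal_norm B (u - x0))\<^sup>2"
    and psi_Suc: "\<And>k u g. \<psi> (Suc k) u g = \<psi> k u g + a (Suc k) * w (Suc k) u g"
    and w_Suc: "\<And>k u g. w (Suc k) u g = simple_lower_bound B L f (y (Suc k)) u g"
    and minimizer: "\<And>k. is_arg_min (case_prod (\<psi> k)) (\<lambda>_. True) (v k, s k)"
    and v_0: "v 0 = x0"
    and s_0: "s 0 = 0"
    and Gamma: "\<And>k. \<Gamma> k = gap B L f A y \<psi> k"
  shows "\<forall>k. \<Gamma> (Suc k) \<ge> \<Gamma> k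
      + ((A k + A (Suc k)) / (2 * L) - (a (Suc k))\<^sup>2 / 2)
          * (dual_norm B (gradient f (y (Suc k))))\<^sup>2
      + blinfun_apply (gradient f (y (Suc k)))
          (A k *\<^sub>R (y k - (1 / L) *\<^sub>R inv B (gradient f (y k)))
            + a (Suc k) *\<^sub>R v k - A (Suc k) *\<^sub>R y (Suc k))"
proof
  fix k
  \<comment> \<open>Unrolling the recursion separates the dual quadratics \<open>D\<close>, the
    linear part \<open>l\<close> and the constants \<open>c\<close>.\<close>
  define D where "D k = (\<lambda>g. \<Sum>i<k. a (Suc i) / (2 * L) * (dual_norm B (g - gradient f (y (Suc i))))\<^sup>2)" for k
  define l where "l k = (\<Sum>i<k. a (Suc i) *\<^sub>R gradient f (y (Suc i)))" for k
  define c where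
    "c k = (\<Sum>i<k. a (Suc i) * (f (y (Suc i)) - blinfun_apply (gradient f (y (Suc i))) (y (Suc i))))" for k
  define P where "P k u = (primal_norm B (u - x0))\<^sup>2 / 2 + blinfun_apply (l k) u + c k" for k u
  have split: "\<psi> k u g = P k u + D k g" for k u g
    by (induction k)
      (simp_all add: psi_0 psi_Suc w_Suc simple_lower_bound_def P_def D_def l_def c_def
        blinfun.bilinear_simps algebra_simps)
  have min: "\<psi> k (v k) (s k) \<le> \<psi> k u g" for k u g
    using minimizer[of k] by (auto simp: is_arg_min_linorder)
  have growth: "\<psi> k u g \<ge> \<psi> k (v k) (s k) + (primal_norm B (u - v k))\<^sup>2 / 2" for u g
  proof -
    \<comment> \<open>A joint minimizer of a separable sum minimizes each summand: fix one argument
      at its optimum and vary the other.\<close>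
    have "P k (v k) \<le> P k u" for u
      using min[of k u "s k"] by (simp add: split)
    from primal_quadratic_at_minimizer[OF B P_def this]
    have "P k u = P k (v k) + (primal_norm B (u - v k))\<^sup>2 / 2" .
    moreover have "D k (s k) \<le> D k g"
      using min[of k "v k" g] by (simp add: split)
    ultimately show ?thesis
      by (simp add: split)
  qed
  define h where "h = gradient f (y k)"
  define h' where "h' = gradient f (y (Suc k))"
  define a' where "a' = a (Suc k)"
  define d where "d = v (Suc k) - v k"
  have a': "a' > 0"
    using a_pos by (simp add: a'_def)
  have A_nonneg: "A k \<ge> 0"
    by (induction k) (use A_0 A_Suc a_pos in \<open>auto intro: add_nonneg_nonneg less_imp_le\<close>)
  have "opt_value (\<psi> (Suc k)) = \<psi> k (v (Suc k)) (s (Suc k))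
      + a' * simple_lower_bound B L f (y (Suc k)) (v (Suc k)) (s (Suc k))"
    by (simp add: opt_value_eq_arg_min[OF minimizer] psi_Suc w_Suc a'_def)
  also have "\<dots> \<ge> opt_value (\<psi> k) + (primal_norm B d)\<^sup>2 / 2
      + a' * (f (y (Suc k)) + blinfun_apply h' (v (Suc k) - y (Suc k)))"
    using growth a' L_pos
    by (intro add_mono mult_left_mono)
      (simp_all add: opt_value_eq_arg_min[OF minimizer] d_def simple_lower_bound_def h'_def)
  finally have "opt_value (\<psi> (Suc k)) \<ge> opt_value (\<psi> k) + (primal_norm B d)\<^sup>2 / 2
      + a' * (f (y (Suc k)) + blinfun_apply h' (v (Suc k) - y (Suc k)))" .
  \<comment> \<open>Young's inequality for the scaled functional \<open>a' *\<^sub>R h'\<close> is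
    the source of the negative term in the squared weight.\<close>
  moreover have "(primal_norm B d)\<^sup>2 / 2 + a' * blinfun_apply h' d \<ge> - (a'\<^sup>2 / 2) * (dual_norm B h')\<^sup>2"
    using pairing_young[OF B, of "a' *\<^sub>R h'" d]
    by (simp add: dual_norm_eq_primal_norm[OF B] linear_scale[OF linear_inv_sym_pos_def[OF B]]
        primal_norm_scaleR[OF B] power_mult_distrib blinfun.bilinear_simps)
  ultimately have opt: "opt_value (\<psi> (Suc k)) \<ge> opt_value (\<psi> k) - a'\<^sup>2 / 2 * (dual_norm B h')\<^sup>2
      + a' * (f (y (Suc k)) + blinfun_apply h' (v k - y (Suc k)))"
    by (simp add: d_def blinfun.bilinear_simps algebra_simps)
  have "A k * simple_lower_bound B L f (y (Suc k)) (y k) h \<le> A k * f (y k)"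
    unfolding h_def
    by (intro mult_left_mono convex_Lipschitz_gradient_lower_bound[OF B convex diff L_pos Lipschitz] A_nonneg)
  \<comment> \<open>The \<open>h\<close> square cancels against the one in
    \<open>\<Gamma> k\<close>, the cross term supplies the gradient step at \<open>y k\<close>, and
    the \<open>h'\<close> square joins that of \<open>\<Gamma> (Suc k)\<close> to give the factor
    \<open>A k + A (Suc k)\<close>.\<close>
  then have "A k * (f (y (Suc k)) + blinfun_apply h' (y k - y (Suc k)))
      + A k / (2 * L) * ((dual_norm B h)\<^sup>2 - 2 * blinfun_apply h' (inv B h) + (dual_norm B h')\<^sup>2)
    \<le> A k * f (y k)"
    by (simp add: simple_lower_bound_def h'_def[symmetric] dual_norm_diff_power2[OF B] distrib_left)
  with opt show "\<Gamma> (Suc k) \<ge> \<Gamma> k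
      + ((A k + A (Suc k)) / (2 * L) - (a (Suc k))\<^sup>2 / 2)
          * (dual_norm B (gradient f (y (Suc k))))\<^sup>2
      + blinfun_apply (gradient f (y (Suc k)))
          (A k *\<^sub>R (y k - (1 / L) *\<^sub>R inv B (gradient f (y k)))
            + a (Suc k) *\<^sub>R v k - A (Suc k) *\<^sub>R y (Suc k))"
    unfolding Gamma gap_def A_Suc h_def[symmetric] h'_def[symmetric] a'_def[symmetric]
    using L_pos by (simp add: blinfun.bilinear_simps add_divide_distrib algebra_simps)
qed

end
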